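(* Let $G$ be a finite cyclic group with $|G|\ge 3$, and let $G_0\subseteq G$ satisfy $\min\Delta(G_0)\ge \log|G|$. Then there exists a subset $G_2\subseteq G_0$ with $|G_2|=2$ that is not half-factorial.
   Context: $\log$ is the natural logarithm. For $G_0\subseteq G$, $\mathcal B(G_0)$ is the monoid of zero-sum sequences over $G_0$ (finite unordered lists of elements of $G_0$ summing to $0$, including the empty one); its atoms are the minimal zero-sum sequences (non-empty, with no proper non-empty zero-sum subsequence). For $B\in\mathcal B(G_0)$, $\mathsf L(B)$ is the set of all $\ell$ such that $B$ is a product of $\ell$ minimal zero-sum sequences. For a finite set $L=\{\ell_1<\dots<\ell_k\}$, $\Delta(L)=\{\ell_{i+1}-\ell_i\}$; $\Delta(G_0)=\bigcup_{B}\Delta(\mathsf L(B))$ and $\min\Delta(G_0)$ is its minimum with the convention $\min\emptyset=0$. $G_0$ is half-factorial if $\Delta(G_0)=\emptyset$, i.e. $|\mathsf L(B)|=1$ for all $B\in\mathcal B(G_0)$. *)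

theory Defs
  imports Complex_Main "HOL-Library.Multiset"
    "HOL-Algebra.FiniteProduct" "HOL-Algebra.Elementary_Groups"
begin

text \<open>
  Abelian groups are written multiplicatively, as in HOL-Algebra: the zero element of the additive
  literature is the group's \<open>\<one>\<close>, and the sum of a sequence is a product. Sequences are finite and
  unordered, that is, multisets; concatenation of sequences is the sum of multisets.
\<close>

definition seq_sum :: "('a, 'b) monoid_scheme \<Rightarrow> 'a multiset \<Rightarrow> 'a" where
  "seq_sum G S = (\<Otimes>\<^bsub>G\<^esub>g\<in>set_mset S. g [^]\<^bsub>G\<^esub> count S g)"

definition zero_sum_seqs :: "('a, 'b) monoid_scheme \<Rightarrow> 'a set \<Rightarrow> 'a multiset set" where
  "zero_sum_seqs G G0 = {S. set_mset S \<subseteq> G0 \<and> seq_sum G S = \<one>\<^bsub>G\<^esub>}"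

definition min_zero_sum_seqs :: "('a, 'b) monoid_scheme \<Rightarrow> 'a set \<Rightarrow> 'a multiset set" where
  "min_zero_sum_seqs G G0 =
    {A \<in> zero_sum_seqs G G0. A \<noteq> {#} \<and> \<not> (\<exists>T. T \<noteq> {#} \<and> T \<subset># A \<and> seq_sum G T = \<one>\<^bsub>G\<^esub>)}"

text \<open>
  A factorization of \<open>B\<close> is a multiset of atoms, and its length is its size; \<open>\<Sum>\<^sub># F\<close> concatenates the
  members of \<open>F\<close>. The empty sequence has the empty factorization, of length \<open>0\<close>.
\<close>

definition length_set :: "('a, 'b) monoid_scheme \<Rightarrow> 'a set \<Rightarrow> 'a multiset \<Rightarrow> nat set" where
  "length_set G G0 B = {size F |F. set_mset F \<subseteq> min_zero_sum_seqs G G0 \<and> \<Sum>\<^sub># F = B}"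

definition successive_distances :: "nat set \<Rightarrow> nat set" where
  "successive_distances L = {m - l |l m. l \<in> L \<and> m \<in> L \<and> l < m \<and> L \<inter> {l<..<m} = {}}"

definition distances :: "('a, 'b) monoid_scheme \<Rightarrow> 'a set \<Rightarrow> nat set" where
  "distances G G0 = (\<Union>B\<in>zero_sum_seqs G G0. successive_distances (length_set G G0 B))"

definition min_distance :: "('a, 'b) monoid_scheme \<Rightarrow> 'a set \<Rightarrow> nat" where
  "min_distance G G0 =
    (if distances G G0 = {} then 0 else (LEAST d. d \<in> distances G G0))"

definition half_factorial :: "('a, 'b) monoid_scheme \<Rightarrow> 'a set \<Rightarrow> bool" where
  "half_factorial G G0 \<longleftrightarrow> distances G G0 = {}"

end

theory Submission
  imports Defs "HOL-Algebra.Multiplicative_Group" "HOL-Number_Theory.Cong"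
    "HOL-Analysis.Complex_Transcendental"
begin

text \<open>
  Suppose every two-element subset of \<open>G0\<close> is half-factorial. Then
  \<open>(ord g / c) g = (ord h / c) h\<close> for \<open>g, h \<in> G0\<close> and \<open>c = gcd (ord g) (ord h)\<close>, and consequently
  a sequence over \<open>G0\<close> is zero-sum iff its cross number (the sum of the \<open>1 / ord g\<close>) is an integer.
  Put \<open>n = |G|\<close> and \<open>d = min \<Delta>(G0)\<close>; note that \<open>d\<close> divides all differences of factorization
  lengths.

  An atom \<open>A\<close> of cross number at least \<open>2\<close> gives \<open>d \<le> |supp A| - 2\<close>, by completing \<open>A\<close> to the
  product of the sequences \<open>g ^ ord g\<close> with \<open>g \<in> supp A\<close>. Take such an \<open>A\<close> of minimal support,
  \<open>g \<in> supp A\<close>, and an atom \<open>U\<close> containing \<open>g\<close> with the least positive multiplicity that occurs in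
  a zero-sum sequence over \<open>supp A\<close>; since \<open>G\<close> is cyclic, \<open>U\<close> needs at most \<open>\<omega>(n)\<close> further elements.
  If \<open>U\<close> has cross number at least \<open>2\<close>, then \<open>d \<le> \<omega>(n) - 1 < log n\<close>. Otherwise \<open>A U ^ j\<close> is, for
  suitable \<open>j\<close>, the product of \<open>g ^ ord g\<close> and of atoms of cross number \<open>1\<close>, so that \<open>d\<close> divides
  \<open>k(A) - 1\<close>, which is less than \<open>log n\<close> because zero-sum free sequences have cross number less
  than \<open>log n\<close>. If there is no such \<open>A\<close>, then \<open>G0\<close> is half-factorial and \<open>d = 0\<close>.
\<close>

section \<open>Divisors of n and residue classes\<close>

text \<open>Greedy choice, one modulus at a time: by pigeonhole some class modulo \<open>m j\<close>
  holds at least a share \<open>1 / m j\<close> of the elements not yet covered. Once the bound is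
  below 1, the chosen classes cover \<open>R\<close>.\<close>

lemma residue_classes_cover:
  fixes m :: "'i \<Rightarrow> nat"
  assumes "finite I" and "\<And>i. i \<in> I \<Longrightarrow> m i > 0" and "finite R"
  shows "\<exists>y. real (card {x \<in> R. \<forall>i\<in>I. x mod m i \<noteq> y i}) \<le> real (card R) * (\<Prod>i\<in>I. 1 - 1 / real (m i))"
  using assms
proof (induction I arbitrary: R rule: finite_induct)
  case empty
  then show ?case by simp
next
  case (insert j I)
  define C where "C r = {x \<in> R. x mod m j = r}" for r
  have mj: "m j > 0" using insert.prems by simp
  have "R = (\<Union>r<m j. C r)"
    using mj by (auto simp: C_def)
  moreover have "card (\<Union>r<m j. C r) = (\<Sum>r<m j. card (C r))"
    using \<open>finite R\<close> by (intro card_UN_disjoint) (auto simp: C_def)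
  ultimately have "card R = (\<Sum>r<m j. card (C r))"
    by simp
  have "\<exists>r<m j. real (card R) / real (m j) \<le> real (card (C r))"
  proof (rule ccontr)
    assume "\<not> ?thesis"
    then have "(\<Sum>r<m j. real (card (C r))) < (\<Sum>r<m j. real (card R) / real (m j))"
      using mj by (intro sum_strict_mono) auto
    also have "\<dots> = real (card R)" using mj by simp
    finally show False using \<open>card R = _\<close> by simp
  qed
  then obtain r where r: "real (card R) / real (m j) \<le> real (card (C r))" by blast
  define R' where "R' = {x \<in> R. x mod m j \<noteq> r}"
  have "card R = card R' + card (C r)"
    using \<open>finite R\<close> unfolding R'_def C_def
    by (subst card_Un_disjoint [symmetric]) (auto intro: arg_cong[where f=card])
  then have R': "real (card R') \<le> real (card R) * (1 - 1 / real (m j))"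
    using r unfolding right_diff_distrib by simp
  have "finite R'" using \<open>finite R\<close> by (simp add: R'_def)
  with insert.IH insert.prems obtain y where
    y: "real (card {x \<in> R'. \<forall>i\<in>I. x mod m i \<noteq> y i}) \<le> real (card R') * (\<Prod>i\<in>I. 1 - 1 / real (m i))"
    by blast
  have pos: "(\<Prod>i\<in>I. 1 - 1 / real (m i)) \<ge> 0"
    using insert.prems by (intro prod_nonneg) (auto simp: Suc_leI)
  have "{x \<in> R. \<forall>i\<in>insert j I. x mod m i \<noteq> (y(j := r)) i} = {x \<in> R'. \<forall>i\<in>I. x mod m i \<noteq> y i}"
    using insert.hyps by (auto simp: R'_def)
  then have "real (card {x \<in> R. \<forall>i\<in>insert j I. x mod m i \<noteq> (y(j := r)) i}) \<le> real (card R') * (\<Prod>i\<in>I. 1 - 1 / real (m i))"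
    using y by simp
  also have "\<dots> \<le> real (card R) * (1 - 1 / real (m j)) * (\<Prod>i\<in>I. 1 - 1 / real (m i))"
    using R' pos by (intro mult_right_mono)
  also have "\<dots> = real (card R) * (\<Prod>i\<in>insert j I. 1 - 1 / real (m i))"
    using insert.hyps by (simp add: mult.assoc)
  finally show ?case
    by (intro exI[of _ "y(j := r)"])
qed

lemma sum_cis_multiples:
  fixes n s :: nat
  assumes "n > 0"
  shows "(\<Sum>x<n. cis (2 * pi * real s * real x / real n)) = (if n dvd s then of_nat n else 0)"
proof -
  define z where "z = cis (2 * pi * real s / real n)"
  have z: "cis (2 * pi * real s * real x / real n) = z ^ x" for x
    unfolding z_def Complex.DeMoivre by (simp add: algebra_simps)
  have "z ^ n = 1"
    unfolding z_def Complex.DeMoivre using assms by (simp add: cis_multiple_2pi)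
  moreover have "z = 1 \<longleftrightarrow> n dvd s"
    using complex_root_unity_eq_1[of n s] assms unfolding z_def cis_conv_exp by (simp add: algebra_simps)
  ultimately show ?thesis
    unfolding z using assms by (auto simp: geometric_sum)
qed

text \<open>Choose residue classes \<open>y i\<close> modulo \<open>n div a i\<close> that cover \<open>{..<n}\<close>. With
  \<open>\<zeta> = exp (2 \<pi> \<i> / n)\<close>, the product of the factors \<open>1 - \<zeta> ^ (a i * (x - y i))\<close> then vanishes
  for all \<open>x\<close>, whereas expanding it and summing over \<open>x\<close> gives \<open>n\<close>.\<close>

lemma zero_sum_free_sum_less:
  fixes a :: "'i \<Rightarrow> nat"
  assumes n: "n \<ge> 2" and I: "finite I" and a: "\<And>i. i \<in> I \<Longrightarrow> a i dvd n"
    and free: "\<And>J. J \<subseteq> I \<Longrightarrow> J \<noteq> {} \<Longrightarrow> \<not> n dvd sum a J"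
  shows "real (sum a I) < real n * ln (real n)"
proof (rule ccontr)
  assume "\<not> ?thesis"
  then have large: "real n * ln (real n) \<le> real (sum a I)" by simp
  define m where "m i = n div a i" for i
  have am: "a i * m i = n" if "i \<in> I" for i using a[OF that] by (simp add: m_def)
  have m: "m i > 0" if "i \<in> I" for i using am[OF that] n by (cases "m i = 0") auto
  have inv_m: "1 / real (m i) = real (a i) / real n" if "i \<in> I" for i
    using am[OF that] m[OF that] n by (simp add: field_simps flip: of_nat_mult)
  have "\<exists>y. real (card {x \<in> {..<n}. \<forall>i\<in>I. x mod m i \<noteq> y i}) \<le> real (card {..<n}) * (\<Prod>i\<in>I. 1 - 1 / real (m i))"
    by (rule residue_classes_cover) (use I m in auto)
  then obtain y where y: "real (card {x \<in> {..<n}. \<forall>i\<in>I. x mod m i \<noteq> y i}) \<le> real n * (\<Prod>i\<in>I. 1 - 1 / real (m i))"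
    by auto
  have I_ne: "I \<noteq> {}"
  proof
    assume "I = {}"
    with large n show False by (simp add: mult_le_0_iff)
  qed
  \<comment> \<open>Each factor uses \<open>1 - x < exp (- x)\<close> at
    \<open>x = a i / n > 0\<close>. The product is below \<open>1 / n\<close>, so fewer than one
    element of \<open>{..<n}\<close> stays uncovered.\<close>
  have "(\<Prod>i\<in>I. 1 - 1 / real (m i)) < (\<Prod>i\<in>I. exp (- (real (a i) / real n)))"
  proof -
    have *: "0 \<le> 1 - 1 / real (m i) \<and> 1 - 1 / real (m i) < exp (- (real (a i) / real n))"
      if "i \<in> I" for i
    proof -
      have "a i \<noteq> 0" using am[OF that] n by (intro notI) simp
      then have "1 - 1 / real (m i) < exp (- (real (a i) / real n))"
        using n inv_m[OF that] by (simp add: exp_minus_greater)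
      with m[OF that] show ?thesis by (simp add: Suc_leI)
    qed
    obtain i where "i \<in> I" using I_ne by blast
    with * I show ?thesis by (intro prod_mono_strict[of i]) (auto simp: less_imp_le)
  qed
  also have "\<dots> = exp (- (real (sum a I) / real n))"
    using I by (simp add: exp_sum [symmetric] sum_negf sum_divide_distrib)
  also have "\<dots> \<le> exp (- ln (real n))"
    using large n by (simp add: field_simps)
  also have "\<dots> = 1 / real n" using n by (simp add: exp_minus field_simps)
  finally have "real n * (\<Prod>i\<in>I. 1 - 1 / real (m i)) < 1"
    using n by (simp add: field_simps)
  with y have "real (card {x \<in> {..<n}. \<forall>i\<in>I. x mod m i \<noteq> y i}) < 1"
    by linarith
  then have "{x \<in> {..<n}. \<forall>i\<in>I. x mod m i \<noteq> y i} = {}"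
    by (simp only: of_nat_less_1_iff card_eq_0_iff) simp
  then have cover: "\<exists>i\<in>I. x mod m i = y i" if "x < n" for x
    using that by blast
  \<comment> \<open>With these choices \<open>w i * f i x + 1\<close> is 1 minus the
    \<open>n\<close>-th root of unity with exponent \<open>a i * (x - y i)\<close>; it vanishes on
    the class \<open>y i\<close> modulo \<open>m i\<close> because
    \<open>a i * m i = n\<close>.\<close>
  define w where "w i = - cis (- (2 * pi * real (a i) * real (y i) / real n))" for i
  define f where "f i x = cis (2 * pi * real (a i) * real x / real n)" for i x
  have vanish: "(\<Prod>i\<in>I. w i * f i x + 1) = 0" if x: "x < n" for x
  proof -
    obtain i where i: "i \<in> I" "x mod m i = y i" using cover[OF x] by blast
    have "real x = real (m i) * real (x div m i) + real (y i)"
      using i(2) by (metis mult_div_mod_eq of_nat_add of_nat_mult)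
    then have "2 * pi * real (a i) * real x / real n =
        2 * pi * real (a i) * real (y i) / real n + 2 * pi * real (x div m i) * (real (a i) * real (m i) / real n)"
      by (simp add: field_simps add_divide_distrib)
    also have "real (a i) * real (m i) / real n = 1"
      using am[OF i(1)] n by (simp flip: of_nat_mult)
    finally have "f i x = cis (2 * pi * real (a i) * real (y i) / real n) * cis (2 * pi * real (x div m i))"
      unfolding f_def cis_mult by simp
    then have "w i * f i x + 1 = 0"
      unfolding w_def by (simp add: cis_multiple_2pi cis_mult)
    with i(1) I show ?thesis by (intro prod_zero) auto
  qed
  have prod_f: "(\<Prod>i\<in>J. f i x) = cis (2 * pi * real (sum a J) * real x / real n)" if "J \<subseteq> I" for J x
    using finite_subset[OF that I]
    by (induction J rule: finite_induct)
       (simp_all add: f_def cis_mult add_divide_distrib ring_distribs)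
  have "0 = (\<Sum>x<n. \<Prod>i\<in>I. w i * f i x + 1)" using vanish by simp
  also have "\<dots> = (\<Sum>x<n. \<Sum>J\<in>Pow I. (\<Prod>i\<in>J. w i) * (\<Prod>i\<in>J. f i x))"
    using I by (simp add: prod_add prod.distrib)
  also have "\<dots> = (\<Sum>J\<in>Pow I. (\<Prod>i\<in>J. w i) * (\<Sum>x<n. \<Prod>i\<in>J. f i x))"
    by (subst sum.swap) (simp add: sum_distrib_left)
  \<comment> \<open>The inner sum is 0 unless \<open>n\<close> divides \<open>sum a J\<close>; by
    \<open>free\<close> only the empty \<open>J\<close> survives.\<close>
  also have "\<dots> = (\<Sum>J\<in>Pow I. if J = {} then of_nat n else 0)"
  proof (intro sum.cong refl)
    fix J assume "J \<in> Pow I"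
    then have "(\<Sum>x<n. \<Prod>i\<in>J. f i x) = (if n dvd sum a J then of_nat n else 0)"
      using n by (simp add: prod_f sum_cis_multiples del: of_nat_sum)
    then show "(\<Prod>i\<in>J. w i) * (\<Sum>x<n. \<Prod>i\<in>J. f i x) = (if J = {} then of_nat n else 0)"
      using free[of J] \<open>J \<in> Pow I\<close> by auto
  qed
  also have "\<dots> = of_nat n" using I by (simp add: sum.delta)
  finally show False using n by simp
qed

section \<open>Linear congruences and the number of prime divisors\<close>

text \<open>Induction on \<open>F\<close>: \<open>t\<close> is chosen so that the gcd of
  \<open>n\<close> and the remaining values divides \<open>s - f j * t\<close>.\<close>

lemma cong_linear_combination:
  fixes f :: "'i \<Rightarrow> nat"
  assumes "finite F" and "n > 0" and "gcd n (Gcd (f ` F)) dvd s"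
  shows "\<exists>x. [(\<Sum>i\<in>F. x i * f i) = s] (mod n)"
  using assms(1,3)
proof (induction F arbitrary: s rule: finite_induct)
  case empty
  then show ?case by (simp add: cong_0_iff cong_sym_eq[of 0])
next
  case (insert j F)
  define D where "D = gcd n (Gcd (f ` F))"
  have "gcd (f j) D dvd s"
    using insert.prems by (simp add: D_def gcd.left_commute gcd.commute gcd.assoc)
  then obtain t where t: "[f j * t = s] (mod D)"
    using cong_solve_dvd_nat by blast
  have "D dvd n" by (simp add: D_def)
  then obtain k where k: "n = D * k" ..
  \<comment> \<open>On naturals, adding \<open>(n - 1) * (f j * t)\<close> stands for subtracting
    \<open>f j * t\<close> modulo \<open>n\<close>.\<close>
  have "[s + (n - 1) * (f j * t) = f j * t + (n - 1) * (f j * t)] (mod D)"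
    using t by (intro cong_add) (auto simp: cong_sym_eq)
  also have "f j * t + (n - 1) * (f j * t) = n * (f j * t)"
    using \<open>n > 0\<close> by (cases n) auto
  finally have "D dvd s + (n - 1) * (f j * t)"
    using \<open>D dvd n\<close> by (simp add: cong_dvd_iff)
  with insert.IH obtain x where x: "[(\<Sum>i\<in>F. x i * f i) = s + (n - 1) * (f j * t)] (mod n)"
    unfolding D_def by blast
  have "[t * f j + (\<Sum>i\<in>F. x i * f i) = t * f j + (s + (n - 1) * (f j * t))] (mod n)"
    using x by (intro cong_add) auto
  also have "t * f j + (s + (n - 1) * (f j * t)) = s + n * (f j * t)"
    using \<open>n > 0\<close> by (cases n) (auto simp: algebra_simps)
  also have "[s + n * (f j * t) = s] (mod n)" by (simp add: cong_def)
  also have "t * f j + (\<Sum>i\<in>F. x i * f i) = (\<Sum>i\<in>insert j F. (x(j := t)) i * f i)"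
    using insert.hyps by (auto intro!: sum.cong)
  finally have "[(\<Sum>i\<in>insert j F. (x(j := t)) i * f i) = s] (mod n)" .
  then show ?case by blast
qed

text \<open>For each prime \<open>p\<close> dividing \<open>n\<close>, one element of least
  \<open>p\<close>-adic valuation fixes the \<open>p\<close>-part of the gcd; other primes cannot
  divide a gcd with \<open>n\<close>. This later keeps the support of an atom small.\<close>

lemma gcd_Gcd_subset:
  fixes f :: "'i \<Rightarrow> nat"
  assumes "finite E" and "n > 0" and pos: "\<And>i. i \<in> E \<Longrightarrow> f i > 0"
  obtains F where "F \<subseteq> E" and "card F \<le> card (prime_factors n)"
    and "gcd n (Gcd (f ` F)) = gcd n (Gcd (f ` E))"
proof (cases "E = {}")
  case True
  then show ?thesis using that[of "{}"] by simp
next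
  case False
  have "\<exists>e\<in>E. \<forall>i\<in>E. multiplicity p (f e) \<le> multiplicity p (f i)" for p
    using arg_min_if_finite[OF \<open>finite E\<close> False, of "\<lambda>i. multiplicity p (f i)"]
    by (metis linorder_not_less)
  then obtain e where e: "\<And>p. e p \<in> E" "\<And>p i. i \<in> E \<Longrightarrow> multiplicity p (f (e p)) \<le> multiplicity p (f i)"
    by metis
  define F where "F = e ` prime_factors n"
  have F: "F \<subseteq> E" "card F \<le> card (prime_factors n)"
    using e(1) by (auto simp: F_def intro: card_image_le)
  have "gcd n (Gcd (f ` F)) dvd f i" if i: "i \<in> E" for i
  proof (rule multiplicity_le_imp_dvd)
    let ?D = "gcd n (Gcd (f ` F))"
    show "?D \<noteq> 0" using \<open>n > 0\<close> by simp
    fix p :: nat assume "prime p"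
    show "multiplicity p ?D \<le> multiplicity p (f i)"
    proof (cases "p dvd n")
      case True
      then have "e p \<in> F" using \<open>prime p\<close> \<open>n > 0\<close> by (auto simp: F_def prime_factors_dvd)
      then have "?D dvd f (e p)" by (meson Gcd_dvd dvd_trans gcd_dvd2 imageI)
      then have "multiplicity p ?D \<le> multiplicity p (f (e p))"
        using pos[OF e(1)] by (intro dvd_imp_multiplicity_le) auto
      with e(2)[OF i, of p] show ?thesis by linarith
    next
      case False
      then have "\<not> p dvd ?D" by (meson dvd_trans gcd_dvd1)
      then show ?thesis by (simp add: not_dvd_imp_multiplicity_0)
    qed
  qed
  then have "gcd n (Gcd (f ` F)) dvd gcd n (Gcd (f ` E))"
    by (auto intro: Gcd_greatest)
  moreover have "gcd n (Gcd (f ` E)) dvd gcd n (Gcd (f ` F))"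
    using F(1) by (intro gcd_mono dvd_refl Gcd_greatest) (auto intro: Gcd_dvd)
  ultimately have "gcd n (Gcd (f ` F)) = gcd n (Gcd (f ` E))"
    by (rule dvd_antisym)
  with F show ?thesis using that by blast
qed

text \<open>The product of the distinct primes divides \<open>n\<close>. Each odd prime contributes
  \<open>ln p \<ge> ln 3 \<ge> 1\<close>; the deficit at 2, where \<open>ln 2 < 1\<close>, is
  absorbed by the \<open>- 1\<close>.\<close>

lemma card_prime_factors_less:
  fixes n :: nat
  assumes "n \<ge> 2"
  shows "real (card (prime_factors n)) - 1 < ln (real n)"
proof -
  define P where "P = prime_factors n"
  have fin: "finite P" by (simp add: P_def)
  have "P \<noteq> {}" using assms by (simp add: P_def prime_factorization_empty_iff)
  have P: "prime p" if "p \<in> P" for p using that by (auto simp: P_def)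
  have ln3: "ln 3 \<ge> (1::real)"
    using exp_le by (simp add: ln_ge_iff)
  have "real (card P) - 1 < real (card (P - {2}))  * ln 3 + (if 2 \<in> P then ln 2 else 0)"
  proof -
    have 1: "real (card (P - {2})) * 1 \<le> real (card (P - {2})) * ln 3"
      using ln3 by (intro mult_left_mono) auto
    have 2: "real (card P) = real (card (P - {2})) + (if 2 \<in> P then 1 else 0)"
      using card.remove[OF fin, of 2] by auto
    have 3: "ln 2 > (0::real)" by simp
    show ?thesis
    proof (cases "2 \<in> P")
      case True
      show ?thesis using 1 2 3 unfolding if_P[OF True] by linarith
    next
      case False
      show ?thesis using 1 2 3 unfolding if_not_P[OF False] by linarith
    qed
  qed
  also have "\<dots> \<le> (\<Sum>p\<in>P. ln (real p))"
  proof -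
    have "real (card (P - {2})) * ln 3 \<le> (\<Sum>p\<in>P-{2}. ln (real p))"
    proof (rule sum_bounded_below)
      fix p assume "p \<in> P - {2}"
      then have "p \<ge> 3" using P[of p] prime_ge_2_nat[of p] by auto
      then show "ln 3 \<le> ln (real p)" by simp
    qed
    then show ?thesis using sum.remove[OF fin, of 2 "\<lambda>p. ln (real p)"] by auto
  qed
  also have "\<dots> = ln (real (\<Prod>p\<in>P. p))"
    using P fin by (subst of_nat_prod, subst ln_prod) (auto simp: prime_gt_0_nat)
  also have "\<dots> \<le> ln (real n)"
  proof -
    have "(\<Prod>p\<in>P. p) dvd (\<Prod>p\<in>P. p ^ multiplicity p n)"
      by (intro prod_dvd_prod) (auto simp: P_def prime_factors_multiplicity intro: dvd_power)
    also have "\<dots> = n"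
      using prod_prime_factors[of n] assms by (simp add: P_def)
    finally have "(\<Prod>p\<in>P. p) \<le> n" using assms by (intro dvd_imp_le) auto
    moreover have "(\<Prod>p\<in>P. p) > 0" using P by (intro prod_pos) (auto simp: prime_gt_0_nat)
    ultimately show ?thesis by (simp del: of_nat_prod)
  qed
  finally show ?thesis by (simp add: P_def)
qed

lemma dvd_sum_mset_image:
  fixes f :: "'b \<Rightarrow> nat"
  shows "(\<And>x. x \<in># S \<Longrightarrow> d dvd f x) \<Longrightarrow> d dvd (\<Sum>x\<in>#S. f x)"
  by (induction S) auto

lemma div_gcd_dvd:
  fixes n w m :: nat
  assumes "n > 0" "n dvd m * w"
  shows "n div gcd n w dvd m"
proof -
  define e where "e = gcd n w"
  have "e > 0" and n: "n = n div e * e" and w: "w = w div e * e"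
    using assms(1) by (simp_all add: e_def)
  from assms(2) have "n div e * e dvd m * (w div e) * e"
    using n w by (metis mult.assoc)
  then have "n div e dvd m * (w div e)" using \<open>e > 0\<close> by simp
  moreover have "coprime (n div e) (w div e)"
    using assms(1) unfolding e_def by (intro div_gcd_coprime) simp
  ultimately show ?thesis unfolding e_def by (simp add: coprime_dvd_mult_left_iff)
qed

lemma set_mset_repeat_subset: "set_mset (repeat_mset k S) \<subseteq> set_mset S"
  by (auto simp flip: count_greater_zero_iff)

section \<open>Sets of lengths\<close>

lemma exists_successive_distance:
  assumes "l \<in> L" "m \<in> L" "l < m"
  shows "\<exists>d\<in>successive_distances L. d \<le> m - l"
proof -
  define k where "k = (LEAST k. k \<in> L \<and> l < k)"
  have k: "k \<in> L" "l < k" using LeastI[of "\<lambda>k. k \<in> L \<and> l < k" m] assms by (auto simp: k_def)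
  have "k \<le> x" if "x \<in> L" "l < x" for x using that by (auto simp: k_def intro: Least_le)
  then have "L \<inter> {l<..<k} = {}" and "k \<le> m" using assms by force+
  then show ?thesis
    using assms k by (intro bexI[of _ "k - l"]) (auto simp: successive_distances_def)
qed

lemma length_setI:
  "set_mset F \<subseteq> min_zero_sum_seqs G G0 \<Longrightarrow> \<Sum>\<^sub># F = B \<Longrightarrow> size F \<in> length_set G G0 B"
  by (auto simp: length_set_def)

lemma length_set_add:
  assumes "l \<in> length_set G G0 B" "l' \<in> length_set G G0 B'"
  shows "l + l' \<in> length_set G G0 (B + B')"
proof -
  obtain F F' where "set_mset F \<subseteq> min_zero_sum_seqs G G0" "\<Sum>\<^sub># F = B" "size F = l"
    "set_mset F' \<subseteq> min_zero_sum_seqs G G0" "\<Sum>\<^sub># F' = B'" "size F' = l'"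
    using assms by (auto simp: length_set_def)
  then show ?thesis using length_setI[of "F + F'" G G0 "B + B'"] by auto
qed

lemma length_set_atom: "A \<in> min_zero_sum_seqs G G0 \<Longrightarrow> 1 \<in> length_set G G0 A"
  using length_setI[of "{#A#}" G G0 A] by simp

lemma length_set_repeat:
  "l \<in> length_set G G0 B \<Longrightarrow> k * l \<in> length_set G G0 (repeat_mset k B)"
proof (induction k)
  case 0
  then show ?case using length_setI[of "{#}" G G0 "{#}"] by simp
next
  case (Suc k)
  then show ?case using length_set_add[of l G G0 B "k * l" "repeat_mset k B"] by simp
qed

lemma min_distance_le_diff:
  assumes "B \<in> zero_sum_seqs G G0" "l \<in> length_set G G0 B" "m \<in> length_set G G0 B" "l < m"
  shows "distances G G0 \<noteq> {}" and "min_distance G G0 \<le> m - l"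
proof -
  obtain d where "d \<in> successive_distances (length_set G G0 B)" "d \<le> m - l"
    using exists_successive_distance[OF assms(2-4)] by blast
  then have d: "d \<in> distances G G0" using assms(1) by (auto simp: distances_def)
  then show "distances G G0 \<noteq> {}" by blast
  with d \<open>d \<le> m - l\<close> show "min_distance G G0 \<le> m - l"
    using Least_le[of "\<lambda>d. d \<in> distances G G0" d] unfolding min_distance_def by simp
qed

lemma min_distance_attained:
  assumes "distances G G0 \<noteq> {}"
  obtains B l where "B \<in> zero_sum_seqs G G0" "l \<in> length_set G G0 B"
    "l + min_distance G G0 \<in> length_set G G0 B" "min_distance G G0 > 0"
proof -
  have "min_distance G G0 \<in> distances G G0"
    using assms LeastI_ex[of "\<lambda>d. d \<in> distances G G0"] by (auto simp: min_distance_def)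
  then obtain B where B: "B \<in> zero_sum_seqs G G0"
    "min_distance G G0 \<in> successive_distances (length_set G G0 B)"
    by (auto simp: distances_def)
  then obtain l m where "min_distance G G0 = m - l" "l \<in> length_set G G0 B" "m \<in> length_set G G0 B" "l < m"
    by (auto simp: successive_distances_def)
  then show ?thesis using that[of B l] B(1) by simp
qed

section \<open>Sequences governed by integral cross numbers\<close>

text \<open>The quotient of \<open>\<Sum>g\<in>#S. a g\<close> by \<open>n\<close> is the cross number of \<open>S\<close> when \<open>a g = n div ord g\<close>.\<close>

locale divisor_weights =
  fixes G :: "('a, 'b) monoid_scheme" and G0 :: "'a set" and n :: nat and a :: "'a \<Rightarrow> nat"
  assumes n_pos: "n > 0"
    and a_dvd: "g \<in> G0 \<Longrightarrow> a g dvd n"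
    and seq_sum_eq_one_iff: "set_mset S \<subseteq> G0 \<Longrightarrow> seq_sum G S = \<one>\<^bsub>G\<^esub> \<longleftrightarrow> n dvd (\<Sum>g\<in>#S. a g)"
begin

section \<open>Atoms, factorizations and distances in terms of weights\<close>

abbreviation wt :: "'a multiset \<Rightarrow> nat" where
  "wt S \<equiv> (\<Sum>g\<in>#S. a g)"

abbreviation atoms :: "'a multiset set" where
  "atoms \<equiv> min_zero_sum_seqs G G0"

lemma a_pos: "g \<in> G0 \<Longrightarrow> a g > 0"
  using a_dvd n_pos by (metis dvd_pos_nat)

lemma wt_pos: "set_mset S \<subseteq> G0 \<Longrightarrow> S \<noteq> {#} \<Longrightarrow> wt S > 0"
  using a_pos by (cases S) auto

lemma wt_repeat: "wt (repeat_mset k S) = k * wt S"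
  by (induction k) auto

lemma zero_sum_seqs_iff: "S \<in> zero_sum_seqs G G0 \<longleftrightarrow> set_mset S \<subseteq> G0 \<and> n dvd wt S"
  using seq_sum_eq_one_iff by (auto simp: zero_sum_seqs_def)

lemma atoms_iff:
  "A \<in> atoms \<longleftrightarrow> set_mset A \<subseteq> G0 \<and> n dvd wt A \<and> A \<noteq> {#} \<and>
     (\<forall>T. T \<noteq> {#} \<longrightarrow> T \<subset># A \<longrightarrow> \<not> n dvd wt T)"
proof (cases "set_mset A \<subseteq> G0")
  case True
  then have "seq_sum G T = \<one>\<^bsub>G\<^esub> \<longleftrightarrow> n dvd wt T" if "T \<subset># A" for T
    using that by (intro seq_sum_eq_one_iff) (meson set_mset_mono subset_mset.less_imp_le subset_trans)
  then show ?thesis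
    by (auto simp: min_zero_sum_seqs_def zero_sum_seqs_iff)
qed (simp add: min_zero_sum_seqs_def zero_sum_seqs_iff)

text \<open>A proper nonempty part and its complement both have positive weight, so the weight of
  the part lies strictly between 0 and \<open>n\<close>.\<close>

lemma atom_of_wt_eq:
  assumes "set_mset A \<subseteq> G0" "wt A = n"
  shows "A \<in> atoms"
proof -
  have "\<not> n dvd wt T" if "T \<noteq> {#}" "T \<subset># A" for T
  proof
    assume "n dvd wt T"
    have "set_mset T \<subseteq> G0" "set_mset (A - T) \<subseteq> G0" "A - T \<noteq> {#}"
      using assms(1) that(2) set_mset_mono[of T A]
      by (auto dest: in_diffD simp: subset_mset.less_le Diff_eq_empty_iff_mset)
    then have "wt T > 0" "wt (A - T) > 0" using that(1) wt_pos by blast+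
    moreover have "wt A = wt T + wt (A - T)"
      using that(2) by (metis image_mset_union subset_mset.add_diff_inverse subset_mset.less_imp_le sum_mset.union)
    ultimately show False using \<open>n dvd wt T\<close> assms(2) by (auto dest: dvd_imp_le)
  qed
  then show ?thesis using assms n_pos by (auto simp: atoms_iff)
qed

lemma factorization:
  assumes "B \<in> zero_sum_seqs G G0"
  obtains F where "set_mset F \<subseteq> atoms" "\<Sum>\<^sub># F = B"
proof -
  have "\<exists>F. set_mset F \<subseteq> atoms \<and> \<Sum>\<^sub># F = B"
    using assms
  proof (induction "size B" arbitrary: B rule: less_induct)
    case less
    consider "B = {#}" | "B \<in> atoms" | T where "T \<noteq> {#}" "T \<subset># B" "n dvd wt T"
      using less.prems by (auto simp: zero_sum_seqs_iff atoms_iff)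
    then show ?case
    proof cases
      case 1
      then show ?thesis by (intro exI[of _ "{#}"]) simp
    next
      case 2
      then show ?thesis by (intro exI[of _ "{#B#}"]) simp
    next
      case 3
      then have B: "B = T + (B - T)" by (simp add: subset_mset.less_imp_le)
      have "wt B = wt T + wt (B - T)" by (subst B) simp
      then have "n dvd wt (B - T)"
        using 3 less.prems by (simp add: zero_sum_seqs_iff dvd_add_right_iff)
      moreover have "set_mset T \<subseteq> G0" "set_mset (B - T) \<subseteq> G0"
        using less.prems 3(2) by (auto simp: zero_sum_seqs_iff dest: mset_subsetD in_diffD)
      moreover have "size T < size B" using 3(2) by (rule mset_subset_size)
      moreover have "size (B - T) < size B"
        using 3 B by (metis add_diff_cancel_left' less_add_same_cancel2 nonempty_has_size size_union)
      ultimately obtain F F' where "set_mset F \<subseteq> atoms" "\<Sum>\<^sub># F = T" "set_mset F' \<subseteq> atoms" "\<Sum>\<^sub># F' = B - T"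
        using less.hyps[of T] less.hyps[of "B - T"] 3(3) by (auto simp: zero_sum_seqs_iff)
      then show ?thesis using B by (intro exI[of _ "F + F'"]) auto
    qed
  qed
  then show ?thesis using that by blast
qed

lemma atom_wt_ge: "A \<in> atoms \<Longrightarrow> n \<le> wt A"
  using wt_pos by (auto simp: atoms_iff dest: dvd_imp_le)

lemma atom_wt_ge_double:
  assumes "A \<in> atoms" "wt A \<noteq> n"
  obtains k where "k \<ge> 2" "wt A = k * n"
proof -
  have "n dvd wt A" using assms(1) by (simp add: atoms_iff)
  then obtain k where k: "wt A = k * n" by (metis dvd_div_mult_self)
  have "k \<noteq> 0" "k \<noteq> 1" using atom_wt_ge[OF assms(1)] assms(2) k n_pos by auto
  then show ?thesis using that[of k] k by linarith
qed

lemma size_le_wt: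
  "set_mset F \<subseteq> atoms \<Longrightarrow> size F * n \<le> wt (\<Sum>\<^sub># F)"
  by (induction F) (auto simp: add_mono atom_wt_ge)

lemma size_eq_wt:
  "(\<And>A. A \<in># F \<Longrightarrow> wt A = n) \<Longrightarrow> size F * n = wt (\<Sum>\<^sub># F)"
  by (induction F) auto

lemma distances_empty:
  assumes "\<And>A. A \<in> atoms \<Longrightarrow> wt A = n"
  shows "distances G G0 = {}"
proof -
  have "l * n = wt B" if l: "l \<in> length_set G G0 B" for l B
  proof -
    obtain F where F: "set_mset F \<subseteq> atoms" "\<Sum>\<^sub># F = B" "l = size F"
      using l by (auto simp: length_set_def)
    have "size F * n = wt (\<Sum>\<^sub># F)" by (rule size_eq_wt) (use F(1) assms in blast)
    then show ?thesis using F by simp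
  qed
  then have "l = m" if "l \<in> length_set G G0 B" "m \<in> length_set G G0 B" for l m B
    using that n_pos by (metis mult_right_cancel less_numeral_extra(3))
  then show ?thesis unfolding distances_def successive_distances_def by blast
qed

text \<open>If \<open>m - l\<close> left a nonzero remainder modulo the minimum distance, then
  \<open>B\<close> joined to \<open>t\<close> copies of a sequence \<open>C\<close> realizing that
  distance would have two lengths differing by the remainder only: trade \<open>l\<close> for
  \<open>m\<close> in \<open>B\<close> and the longer factorization for the shorter one in each copy
  of \<open>C\<close>.\<close>

lemma min_distance_dvd:
  assumes "B \<in> zero_sum_seqs G G0" "l \<in> length_set G G0 B" "m \<in> length_set G G0 B" "l \<le> m"
  shows "min_distance G G0 dvd m - l"
proof (rule ccontr)
  let ?d = "min_distance G G0"
  assume not_dvd: "\<not> ?d dvd m - l"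
  then have "l < m" using assms(4) by (cases "l = m") auto
  then have "distances G G0 \<noteq> {}" using min_distance_le_diff(1) assms(1-3) by blast
  then obtain C k where C: "C \<in> zero_sum_seqs G G0" "k \<in> length_set G G0 C"
    "k + ?d \<in> length_set G G0 C" "?d > 0"
    by (rule min_distance_attained)
  define t where "t = (m - l) div ?d"
  have t: "m = l + t * ?d + (m - l) mod ?d"
    using \<open>l < m\<close> unfolding t_def by (metis add.assoc div_mult_mod_eq le_add_diff_inverse less_imp_le)
  have r: "0 < (m - l) mod ?d" "(m - l) mod ?d < ?d"
    using not_dvd C(4) by (auto simp: dvd_eq_mod_eq_0)
  define Z where "Z = repeat_mset t C + B"
  have "Z \<in> zero_sum_seqs G G0"
    using C(1) assms(1) unfolding Z_def
    by (auto simp: zero_sum_seqs_iff wt_repeat simp flip: count_greater_zero_iff)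
  moreover have "t * (k + ?d) + l \<in> length_set G G0 Z" "t * k + m \<in> length_set G G0 Z"
    unfolding Z_def using C assms by (blast intro: length_set_add length_set_repeat)+
  moreover have "t * (k + ?d) + l < t * k + m"
    using t r by (simp add: algebra_simps)
  ultimately have "?d \<le> t * k + m - (t * (k + ?d) + l)" by (rule min_distance_le_diff)
  also have "\<dots> = (m - l) mod ?d" by (subst t) (simp add: algebra_simps)
  finally show False using r by simp
qed

lemma wt_power_atom: "g \<in> G0 \<Longrightarrow> wt (replicate_mset (n div a g) g) = n"
  using a_dvd by simp

lemma power_atom: "g \<in> G0 \<Longrightarrow> replicate_mset (n div a g) g \<in> atoms"
  using wt_power_atom by (intro atom_of_wt_eq) auto

lemma count_less_of_wt_neq:
  assumes "A \<in> atoms" "wt A \<noteq> n" "g \<in> G0"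
  shows "count A g < n div a g"
proof (rule ccontr)
  assume "\<not> ?thesis"
  then have "replicate_mset (n div a g) g \<subseteq># A" by (simp flip: count_le_replicate_mset_subset_eq)
  moreover have "replicate_mset (n div a g) g \<noteq> A" using assms wt_power_atom by metis
  ultimately have "replicate_mset (n div a g) g \<subset># A" by (simp add: subset_mset.less_le)
  moreover have "replicate_mset (n div a g) g \<noteq> {#}"
    using power_atom[OF assms(3)] by (simp add: atoms_iff)
  moreover have "n dvd wt (replicate_mset (n div a g) g)" using wt_power_atom assms(3) by simp
  ultimately show False using assms(1) unfolding atoms_iff by blast
qed

text \<open>No multiplicity in \<open>A\<close> reaches that of the power atom, so \<open>A\<close>
  divides the product \<open>V\<close> of the power atoms over its support. This gives
  \<open>V\<close> a second factorization, through \<open>A\<close> and the cofactor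
  \<open>W\<close>.\<close>

lemma min_distance_le_card:
  assumes "A \<in> atoms" "wt A \<noteq> n"
  shows "min_distance G G0 + 2 \<le> card (set_mset A)"
proof -
  define U where "U g = replicate_mset (n div a g) g" for g
  have A0: "set_mset A \<subseteq> G0" using assms(1) by (simp add: atoms_iff)
  define V where "V = \<Sum>\<^sub># (image_mset U (mset_set (set_mset A)))"
  define s where "s = card (set_mset A)"
  have U: "U g \<in> atoms" "wt (U g) = n" if "g \<in># A" for g
    using that A0 power_atom wt_power_atom unfolding U_def by auto
  have sV: "s \<in> length_set G G0 V"
    using length_setI[of "image_mset U (mset_set (set_mset A))" G G0 V] U(1) by (auto simp: V_def s_def)
  have "size (image_mset U (mset_set (set_mset A))) * n = wt V"
    unfolding V_def by (rule size_eq_wt) (use U(2) in auto)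
  then have wtV: "wt V = s * n" by (simp add: s_def)
  have count_V: "count V g = (if g \<in># A then n div a g else 0)" for g
    unfolding V_def sum_unfold_sum_mset [symmetric] count_sum U_def
    by (simp add: sum.delta count_replicate_mset)
  have less: "count A g < count V g" if "g \<in># A" for g
    using count_less_of_wt_neq[OF assms] that A0 count_V by auto
  then have "A \<subseteq># V"
    by (intro mset_subset_eqI) (metis less_imp_le not_in_iff zero_le)
  define W where "W = V - A"
  have V: "V = A + W" using \<open>A \<subseteq># V\<close> by (simp add: W_def)
  have "set_mset V \<subseteq> G0"
    using A0 count_V by (metis count_eq_zero_iff subset_iff)
  then have W0: "set_mset W \<subseteq> G0" by (auto simp: V)
  have wtAW: "wt A + wt W = s * n" using wtV by (simp add: V)
  then have "n dvd wt W"
    using assms(1) by (metis atoms_iff dvd_add_right_iff dvd_triv_right)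
  then have "W \<in> zero_sum_seqs G G0" using W0 by (simp add: zero_sum_seqs_iff)
  then obtain F where F: "set_mset F \<subseteq> atoms" "\<Sum>\<^sub># F = W" by (rule factorization)
  obtain g where "g \<in># A" using assms(1) by (auto simp: atoms_iff)
  then have "W \<noteq> {#}" using less[of g] by (auto simp: V)
  then have "size F \<noteq> 0" using F(2) by auto
  \<comment> \<open>\<open>A\<close> weighs at least \<open>2 * n\<close> and every atom at least
    \<open>n\<close>, so at most \<open>s - 2\<close> atoms remain for \<open>W\<close>. With
    \<open>size F \<noteq> 0\<close>, the lengths \<open>s\<close> and \<open>1 + size F\<close>
    then differ by a positive number not exceeding \<open>s - 2\<close>.\<close>
  have "size F * n + 2 * n \<le> s * n"
    using size_le_wt[OF F(1)] F(2) wtAW atom_wt_ge_double[OF assms]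
    by (metis add.commute add_mono mult_le_mono1)
  then have "size F + 2 \<le> s" using n_pos by (metis add_mult_distrib mult_le_cancel2)
  have "1 + size F \<in> length_set G G0 V"
    unfolding V using length_set_atom[OF assms(1)] length_setI[OF F] by (rule length_set_add)
  moreover have "V \<in> zero_sum_seqs G G0"
    using \<open>set_mset V \<subseteq> G0\<close> wtV by (simp add: zero_sum_seqs_iff)
  ultimately have "min_distance G G0 dvd s - (1 + size F)"
    using sV \<open>size F + 2 \<le> s\<close> by (intro min_distance_dvd) auto
  then have "min_distance G G0 \<le> s - (1 + size F)"
    using \<open>size F + 2 \<le> s\<close> by (intro dvd_imp_le) auto
  then show ?thesis using \<open>size F + 2 \<le> s\<close> \<open>size F \<noteq> 0\<close> unfolding s_def by linarith
qed

text \<open>Removing one element leaves a zero-sum free sequence of weight below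
  \<open>n * ln n\<close>, and the removed element weighs at most \<open>n\<close>.\<close>

lemma atom_wt_less:
  assumes "n \<ge> 2" "A \<in> atoms"
  shows "real (wt A) < real n * (ln (real n) + 1)"
proof -
  obtain g S where A: "A = add_mset g S"
    using assms(2) by (metis atoms_iff multiset_cases)
  \<comment> \<open>Listing \<open>S\<close> turns repeated elements into distinct indices, so that
    \<open>zero_sum_free_sum_less\<close> applies.\<close>
  obtain xs where xs: "mset xs = S" using ex_mset by blast
  have A0: "set_mset A \<subseteq> G0" using assms(2) by (simp add: atoms_iff)
  have wt_J: "wt (image_mset ((!) xs) (mset_set J)) = (\<Sum>i\<in>J. a (xs ! i))" for J
    by (simp add: sum_unfold_sum_mset image_mset.compositionality comp_def)
  have S: "S = image_mset ((!) xs) (mset_set {..<length xs})"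
    unfolding xs [symmetric] by (metis map_nth mset_map mset_upt lessThan_atLeast0)
  have "real (\<Sum>i\<in>{..<length xs}. a (xs ! i)) < real n * ln (real n)"
  proof (intro zero_sum_free_sum_less assms(1))
    show "a (xs ! i) dvd n" if "i \<in> {..<length xs}" for i
    proof -
      have "xs ! i \<in># A" using that by (simp add: A flip: xs)
      then show ?thesis using A0 a_dvd by blast
    qed
    fix J assume J: "J \<subseteq> {..<length xs}" "J \<noteq> {}"
    let ?T = "image_mset ((!) xs) (mset_set J)"
    have "?T \<subseteq># S" by (subst S) (intro image_mset_subseteq_mono subset_imp_msubset_mset_set J(1) finite_lessThan)
    moreover have "S \<subset># A" by (simp add: A)
    ultimately have "?T \<subset># A" by (rule subset_mset.le_less_trans)
    moreover have "?T \<noteq> {#}"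
      using J finite_subset[OF J(1)] by (simp add: mset_set_empty_iff)
    ultimately show "\<not> n dvd (\<Sum>i\<in>J. a (xs ! i))"
      using assms(2) unfolding wt_J [symmetric] atoms_iff by blast
  qed simp
  then have "real (wt S) < real n * ln (real n)" by (subst S) (simp only: wt_J)
  moreover have "a g \<le> n" using A0 a_dvd n_pos unfolding A by (auto intro: dvd_imp_le)
  then have "real (a g) \<le> real n" by simp
  moreover have "real (wt A) = real (a g) + real (wt S)" by (simp add: A)
  ultimately show ?thesis by (simp add: algebra_simps)
qed

lemma min_distance_less_ln:
  assumes "n \<ge> 2" "A' \<in> atoms" "wt A' \<noteq> n"
  shows "real (min_distance G G0) < ln (real n)"
proof -
  obtain A where A: "A \<in> atoms" "wt A \<noteq> n"
    and A_min: "\<And>B. B \<in> atoms \<Longrightarrow> wt B \<noteq> n \<Longrightarrow> card (set_mset A) \<le> card (set_mset B)"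
    using ex_has_least_nat[of "\<lambda>A. A \<in> atoms \<and> wt A \<noteq> n" A' "\<lambda>A. card (set_mset A)"] assms(2,3) by blast
  have A0: "set_mset A \<subseteq> G0" and wt_A: "n dvd wt A" and "A \<noteq> {#}" using A(1) by (auto simp: atoms_iff)
  then obtain g where g: "g \<in># A" by blast
  then have g0: "g \<in> G0" using A0 by blast
  define E where "E = set_mset A - {g}"
  have E: "finite E" "E \<subseteq> G0" "g \<notin> E" "set_mset A = insert g E"
    using A0 g by (auto simp: E_def)
  \<comment> \<open>\<open>E\<close> has one element fewer than the minimal support of an atom whose
    weight is not \<open>n\<close>.\<close>
  have small: "wt B = n" if "B \<in> atoms" "set_mset B \<subseteq> E" for B
  proof (rule ccontr)
    assume "wt B \<noteq> n"
    with that have "card (set_mset A) \<le> card (set_mset B)" by (intro A_min)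
    also have "\<dots> \<le> card E" using that E(1) by (intro card_mono)
    finally show False using E by simp
  qed
  obtain F where F: "F \<subseteq> E" "card F \<le> card (prime_factors n)" "gcd n (Gcd (a ` F)) = gcd n (Gcd (a ` E))"
    using gcd_Gcd_subset[of E n a] E a_pos n_pos by blast
  have "finite F" using F(1) E(1) by (rule finite_subset)
  define D where "D = gcd n (Gcd (a ` E))"
  have "D dvd n" by (simp add: D_def)
  have D_a: "D dvd a e" if "e \<in> E" for e
    unfolding D_def using that by (intro dvd_trans[OF gcd_dvd2] Gcd_dvd) auto
  have "D > 0" using n_pos by (simp add: D_def)
  have split: "B = replicate_mset (count B g) g + filter_mset (\<lambda>x. x \<noteq> g) B" for B
    by (metis filter_eq_replicate_mset multiset_partition)
  \<comment> \<open>Modulo \<open>n\<close>, the weights of sequences over \<open>E\<close> are the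
    multiples of \<open>D\<close>. Hence \<open>q\<close>, the least positive number with
    \<open>D dvd q * a g\<close>, is the least positive multiplicity of \<open>g\<close> in a
    zero-sum sequence over \<open>insert g E\<close>.\<close>
  define q where "q = D div gcd D (a g)"
  have "q > 0" using \<open>D > 0\<close> unfolding q_def by (metis dvd_div_eq_0_iff gcd_dvd1 neq0_conv)
  have "D dvd q * a g"
    unfolding q_def by (metis dvd_div_mult dvd_triv_left gcd_dvd1 gcd_dvd2 dvd_div_mult_self mult.commute mult_dvd_mono)
  have q_dvd: "q dvd count B g" if B: "n dvd wt B" "set_mset B \<subseteq> insert g E" for B
  proof -
    have "D dvd wt (filter_mset (\<lambda>x. x \<noteq> g) B)"
      using B(2) by (intro dvd_sum_mset_image) (auto intro: D_a)
    moreover have "wt B = count B g * a g + wt (filter_mset (\<lambda>x. x \<noteq> g) B)"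
      by (subst split) simp
    moreover have "D dvd wt B" using \<open>D dvd n\<close> B(1) by (rule dvd_trans)
    ultimately have "D dvd count B g * a g" by (simp add: dvd_add_left_iff)
    then show ?thesis
      unfolding q_def using \<open>D > 0\<close> by (intro div_gcd_dvd)
  qed
  \<comment> \<open>The weight still missing is \<open>- q * a g\<close> modulo \<open>n\<close>,
    written \<open>(n - 1) * (q * a g)\<close>. Passing from \<open>E\<close> to \<open>F\<close>
    keeps the gcd, so elements of \<open>F\<close> suffice.\<close>
  obtain x where x: "[(\<Sum>i\<in>F. x i * a i) = (n - 1) * (q * a g)] (mod n)"
    using cong_linear_combination[OF \<open>finite F\<close> n_pos, of a] F(3) \<open>D dvd q * a g\<close> unfolding D_def
    by (metis dvd_mult)
  define B where "B = replicate_mset q g + (\<Sum>i\<in>F. replicate_mset (x i) i)"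
  have "wt (\<Sum>i\<in>F. replicate_mset (x i) i) = (\<Sum>i\<in>F. x i * a i)"
    using \<open>finite F\<close> by (induction F rule: finite_induct) auto
  then have "[wt B = q * a g + (n - 1) * (q * a g)] (mod n)"
    using x by (simp add: B_def cong_add)
  also have "q * a g + (n - 1) * (q * a g) = n * (q * a g)"
    using n_pos by (cases n) auto
  finally have "n dvd wt B" by (simp add: cong_dvd_iff)
  have set_B: "set_mset B \<subseteq> insert g F"
    using \<open>finite F\<close> by (auto simp: B_def set_mset_sum split: if_splits)
  have count_B: "count B g = q"
    using F(1) E(3) by (auto simp: B_def count_sum count_replicate_mset intro!: sum.neutral)
  have "B \<in> zero_sum_seqs G G0"
    using \<open>n dvd wt B\<close> set_B F(1) E(2) g0 by (auto simp: zero_sum_seqs_iff)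
  then obtain H where H: "set_mset H \<subseteq> atoms" "\<Sum>\<^sub># H = B" by (rule factorization)
  have "g \<in># \<Sum>\<^sub># H" using H(2) count_B \<open>q > 0\<close> by (metis count_greater_zero_iff)
  then obtain U where U: "U \<in># H" "g \<in># U" by auto
  then have "U \<in> atoms" using H(1) by blast
  have "U \<subseteq># B" using U(1) H(2) by (metis mset_subset_eq_add_left multi_member_split sum_mset.add_mset)
  then have set_U: "set_mset U \<subseteq> insert g F" using set_B set_mset_mono by blast
  have "q dvd count U g"
    using \<open>U \<in> atoms\<close> set_U F(1) by (intro q_dvd) (auto simp: atoms_iff)
  moreover have "count U g \<le> q" using \<open>U \<subseteq># B\<close> count_B by (metis mset_subset_eq_count)
  moreover have "count U g > 0" using U(2) by simp
  ultimately have count_U: "count U g = q" by (metis dvd_imp_le le_antisym)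
  show ?thesis
  proof (cases "wt U = n")
    case False
    have "min_distance G G0 + 2 \<le> card (set_mset U)"
      using \<open>U \<in> atoms\<close> False by (rule min_distance_le_card)
    also have "\<dots> \<le> card (insert g F)" using \<open>finite F\<close> set_U by (intro card_mono) auto
    also have "\<dots> \<le> card (prime_factors n) + 1"
      using F(2) \<open>finite F\<close> by (simp add: card_insert_if)
    finally have "real (min_distance G G0) \<le> real (card (prime_factors n)) - 1" by linarith
    also have "\<dots> < ln (real n)" using assms(1) by (rule card_prime_factors_less)
    finally show ?thesis .
  next
    case True
    obtain k where k: "k \<ge> 2" "wt A = k * n" using A by (rule atom_wt_ge_double)
    define m where "m = n div a g"
    \<comment> \<open>\<open>q\<close> divides the multiplicity of \<open>g\<close> in
      \<open>A\<close> and in the power atom of \<open>g\<close>, so copies of \<open>U\<close>,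
      each with \<open>g\<close> exactly \<open>q\<close> times, fill the gap between them.\<close>
    have "q dvd m"
      using q_dvd[of "replicate_mset m g"] wt_power_atom[OF g0] by (simp add: m_def)
    moreover have "q dvd count A g" using wt_A E by (intro q_dvd) auto
    moreover have "count A g \<le> m"
      using count_less_of_wt_neq[OF A g0] by (simp add: m_def)
    ultimately obtain j where j: "count A g + j * q = m"
      by (metis dvd_diff_nat dvd_div_mult_self le_add_diff_inverse)
    define V where "V = A + repeat_mset j U"
    define W where "W = filter_mset (\<lambda>x. x \<noteq> g) V"
    have "count V g = m" using j count_U by (simp add: V_def)
    then have V: "V = replicate_mset m g + W" unfolding W_def using split by metis
    have set_V: "set_mset V \<subseteq> insert g E"
      using E(4) set_U F(1) set_mset_repeat_subset[of j U] unfolding V_def set_mset_union by blast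
    then have set_W: "set_mset W \<subseteq> E" by (auto simp: W_def)
    have wt_V: "wt V = (k + j) * n" using True k by (simp add: V_def wt_repeat algebra_simps)
    have wt_VW: "wt V = n + wt W"
      using wt_power_atom[OF g0] by (subst V) (simp add: m_def)
    then have "n dvd wt W" using wt_V by (metis dvd_add_right_iff dvd_refl dvd_triv_right)
    then have "W \<in> zero_sum_seqs G G0" using set_W E(2) by (auto simp: zero_sum_seqs_iff)
    then obtain K where K: "set_mset K \<subseteq> atoms" "\<Sum>\<^sub># K = W" by (rule factorization)
    \<comment> \<open>\<open>W\<close> avoids \<open>g\<close>, so its atoms all have weight
      \<open>n\<close> and weights determine \<open>size K\<close>. The two lengths of
      \<open>V\<close> are \<open>k + j\<close> and \<open>1 + j\<close>; their difference
      \<open>k - 1\<close> does not depend on \<open>j\<close>.\<close>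
    have "wt C = n" if "C \<in># K" for C
    proof (rule small)
      show "C \<in> atoms" using that K(1) by blast
      show "set_mset C \<subseteq> E" using that K(2) set_W by auto
    qed
    then have "size K * n = wt W" using size_eq_wt K(2) by blast
    then have "(1 + size K) * n = (k + j) * n" using wt_V wt_VW by simp
    then have size_K: "1 + size K = k + j" using n_pos by (metis mult_right_cancel less_numeral_extra(3))
    have "1 + size K \<in> length_set G G0 V"
      unfolding V m_def using length_set_atom[OF power_atom[OF g0]] length_setI[OF K] by (rule length_set_add)
    moreover have "1 + j \<in> length_set G G0 V"
      unfolding V_def using length_set_add[OF length_set_atom[OF A(1)] length_set_repeat[OF length_set_atom[OF \<open>U \<in> atoms\<close>], of j]]
      by simp
    moreover have "V \<in> zero_sum_seqs G G0"
      using set_V E(2) g0 wt_V by (auto simp: zero_sum_seqs_iff)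
    ultimately have "min_distance G G0 dvd (k + j) - (1 + j)"
      unfolding size_K using k(1) by (intro min_distance_dvd) auto
    then have "min_distance G G0 \<le> k - 1"
      using k(1) by (intro dvd_imp_le) auto
    then have "real (min_distance G G0) \<le> real k - 1" using k(1) by linarith
    also have "\<dots> < ln (real n)"
    proof -
      have "real n * real k < real n * (ln (real n) + 1)"
        using atom_wt_less[OF assms(1) A(1)] k(2) by (simp add: mult.commute)
      then have "real k < ln (real n) + 1" using n_pos by simp
      then show ?thesis by simp
    qed
    finally show ?thesis .
  qed
qed

end

section \<open>Pairwise half-factorial sets in cyclic groups\<close>

context comm_group
begin

section \<open>Sums of sequences in a commutative group\<close>

lemma pow_mod_ord:
  assumes "x \<in> carrier G"
  shows "x [^] (k mod ord x) = x [^] k"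
proof -
  have "x [^] k = x [^] (ord x * (k div ord x)) \<otimes> x [^] (k mod ord x)"
    using assms by (simp add: nat_pow_mult)
  also have "x [^] (ord x * (k div ord x)) = \<one>" using assms by (simp add: pow_eq_id)
  finally show ?thesis using assms by simp
qed

lemma seq_sum_superset:
  assumes "finite X" "set_mset S \<subseteq> X" "X \<subseteq> carrier G"
  shows "seq_sum G S = (\<Otimes>x\<in>X. x [^] count S x)"
  unfolding seq_sum_def using assms
  by (intro finprod_mono_neutral_cong_left) (auto simp: not_in_iff)

lemma seq_sum_closed: "set_mset S \<subseteq> carrier G \<Longrightarrow> seq_sum G S \<in> carrier G"
  unfolding seq_sum_def by (intro finprod_closed) auto

lemma seq_sum_union:
  assumes "set_mset S \<subseteq> carrier G" "set_mset T \<subseteq> carrier G"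
  shows "seq_sum G (S + T) = seq_sum G S \<otimes> seq_sum G T"
proof -
  have "seq_sum G R = (\<Otimes>x\<in>set_mset (S + T). x [^] count R x)" if "set_mset R \<subseteq> set_mset (S + T)" for R
    using that assms by (intro seq_sum_superset) auto
  then have "seq_sum G (S + T) = (\<Otimes>x\<in>set_mset (S + T). x [^] count (S + T) x)"
    "seq_sum G S = (\<Otimes>x\<in>set_mset (S + T). x [^] count S x)"
    "seq_sum G T = (\<Otimes>x\<in>set_mset (S + T). x [^] count T x)"
    by auto
  moreover have "(\<Otimes>x\<in>set_mset (S + T). x [^] count (S + T) x) =
      (\<Otimes>x\<in>set_mset (S + T). x [^] count S x \<otimes> x [^] count T x)"
    using assms by (intro finprod_cong') (auto simp: nat_pow_mult)
  moreover have "\<dots> = (\<Otimes>x\<in>set_mset (S + T). x [^] count S x) \<otimes> (\<Otimes>x\<in>set_mset (S + T). x [^] count T x)"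
    using assms by (intro finprod_multf) auto
  ultimately show ?thesis by simp
qed

lemma seq_sum_replicate:
  assumes "g \<in> carrier G"
  shows "seq_sum G (replicate_mset k g) = g [^] k"
  using seq_sum_superset[of "{g}" "replicate_mset k g"] assms by (simp split: if_splits)

lemma seq_sum_empty [simp]: "seq_sum G {#} = \<one>"
  by (simp add: seq_sum_def)

lemma seq_sum_add_mset:
  assumes "g \<in> carrier G" "set_mset S \<subseteq> carrier G"
  shows "seq_sum G (add_mset g S) = g \<otimes> seq_sum G S"
  using seq_sum_union[of "{#g#}" S] seq_sum_replicate[of g 1] assms by simp

lemma seq_sum_repeat:
  assumes "set_mset S \<subseteq> carrier G" "seq_sum G S = \<one>"
  shows "seq_sum G (repeat_mset k S) = \<one>"
proof (induction k)
  case (Suc k)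
  have "set_mset (repeat_mset k S) \<subseteq> carrier G"
    using assms(1) set_mset_repeat_subset[of k S] by blast
  then show ?case using Suc assms seq_sum_union[of S "repeat_mset k S"] by simp
qed simp

lemma seq_sum_pow:
  assumes "h \<in> carrier G" "\<And>g. g \<in># S \<Longrightarrow> g \<in> carrier G" "\<And>g. g \<in># S \<Longrightarrow> g [^] M = h [^] (e g :: nat)"
  shows "seq_sum G S [^] (M::nat) = h [^] (\<Sum>g\<in>#S. e g)"
  using assms(2,3)
proof (induction S)
  case (add g S)
  have gS: "g \<in> carrier G" "set_mset S \<subseteq> carrier G" using add.prems by auto
  have "seq_sum G (add_mset g S) [^] M = g [^] M \<otimes> seq_sum G S [^] M"
    using gS seq_sum_closed by (simp add: seq_sum_add_mset nat_pow_distrib)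
  also have "\<dots> = h [^] e g \<otimes> h [^] (\<Sum>g\<in>#S. e g)" using add by simp
  finally show ?case using assms(1) by (simp add: nat_pow_mult)
qed simp

lemma power_atom_seq:
  assumes "g \<in> carrier G" "g \<in> G0" "ord g > 0"
  shows "replicate_mset (ord g) g \<in> min_zero_sum_seqs G G0"
proof -
  have "seq_sum G T \<noteq> \<one>" if T: "T \<noteq> {#}" "T \<subset># replicate_mset (ord g) g" for T
  proof
    assume *: "seq_sum G T = \<one>"
    obtain k where T_eq: "T = replicate_mset k g"
      using T(2) by (metis msubseteq_replicate_msetE subset_mset.less_imp_le)
    have "k < ord g" using mset_subset_size[OF T(2)] by (simp add: T_eq)
    moreover have "k > 0" using T(1) T_eq by auto
    moreover have "ord g dvd k" using * assms by (simp add: T_eq seq_sum_replicate pow_eq_id)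
    ultimately show False by (auto dest: dvd_imp_le)
  qed
  then show ?thesis
    using assms by (auto simp: min_zero_sum_seqs_def zero_sum_seqs_def seq_sum_replicate)
qed

section \<open>Half-factorial pairs and the resulting zero-sum criterion\<close>

text \<open>Let \<open>k\<close> be the least positive number for which \<open>h [^] k\<close> is a
  power of \<open>g\<close>. Half-factoriality forces the atom of \<open>k\<close> copies of
  \<open>h\<close> and suitable \<open>b\<close> copies of \<open>g\<close> to have cross number 1,
  that is \<open>k / ord h + b / ord g = 1\<close>. With the minimality of \<open>k\<close> this
  determines \<open>k\<close> and \<open>b\<close>.\<close>

lemma half_factorial_pair:
  assumes gh: "g \<in> carrier G" "h \<in> carrier G" "g \<noteq> h" and pos: "ord g > 0" "ord h > 0"
    and hf: "half_factorial G {g, h}"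
    and ex: "\<exists>b. h [^] (ord h div gcd (ord g) (ord h)) = g [^] (b::nat)"
  shows "g [^] (ord g div gcd (ord g) (ord h)) = h [^] (ord h div gcd (ord g) (ord h))"
proof -
  define c where "c = gcd (ord g) (ord h)"
  have "c > 0" using pos by (simp add: c_def)
  have og: "ord g = c * (ord g div c)" and oh: "ord h = c * (ord h div c)"
    by (simp_all add: c_def)
  have inverse_power: "\<exists>b'<ord g. x \<otimes> g [^] b' = \<one>" if x: "x = g [^] (b::nat)" for x b
  proof -
    have "x \<otimes> g [^] ((ord g - 1) * b) = g [^] (ord g * b)"
      using gh pos unfolding x by (cases "ord g") (simp_all add: nat_pow_mult algebra_simps)
    also have "\<dots> = \<one>" using gh by (simp add: pow_eq_id)
    finally have "x \<otimes> g [^] (((ord g - 1) * b) mod ord g) = \<one>"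
      using gh by (metis pow_mod_ord)
    then show ?thesis using pos by (intro exI[of _ "((ord g - 1) * b) mod ord g"]) simp
  qed
  \<comment> \<open>Requiring \<open>b < ord g\<close> keeps the power atom of \<open>g\<close> out
    of \<open>A\<close>, as the minimality of \<open>A\<close> demands.\<close>
  define P where "P k \<longleftrightarrow> k > 0 \<and> (\<exists>b<ord g. h [^] k \<otimes> g [^] b = \<one>)" for k :: nat
  define k where "k = (LEAST k. P k)"
  have P0: "P (ord h div c)"
    using ex inverse_power oh pos unfolding P_def c_def [symmetric] by (metis gr0I mult_0_right less_numeral_extra(3))
  then have "P k" unfolding k_def by (rule LeastI)
  then obtain b where k: "k > 0" and b: "b < ord g" "h [^] k \<otimes> g [^] b = \<one>" by (auto simp: P_def)
  have k_le: "k \<le> i" if "P i" for i using that unfolding k_def by (rule Least_le)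
  define A where "A = replicate_mset k h + replicate_mset b g"
  have sum2: "seq_sum G (replicate_mset i h + replicate_mset j g) = h [^] i \<otimes> g [^] j" for i j
    using gh by (subst seq_sum_union) (auto simp: seq_sum_replicate split: if_splits)
  have A: "A \<in> min_zero_sum_seqs G {g, h}"
  proof -
    have "seq_sum G T \<noteq> \<one>" if "T \<noteq> {#}" "T \<subset># A" for T
    proof
      assume *: "seq_sum G T = \<one>"
      define i j where "i = count T h" and "j = count T g"
      have "set_mset T \<subseteq> set_mset A" using that(2) by (intro set_mset_mono) simp
      then have "set_mset T \<subseteq> {g, h}" by (auto simp: A_def split: if_splits)
      then have T: "T = replicate_mset i h + replicate_mset j g"
        using gh(3) by (intro multiset_eqI) (auto simp: i_def j_def count_replicate_mset not_in_iff)
      have "T \<subseteq># A" using that(2) by simp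
      then have ij: "i \<le> k" "j \<le> b"
        using gh(3) mset_subset_eq_count[of T A h] mset_subset_eq_count[of T A g]
        by (auto simp: i_def j_def A_def count_replicate_mset)
      have eq: "h [^] i \<otimes> g [^] j = \<one>" using * sum2 T by simp
      show False
      proof (cases "i = 0")
        case True
        then have "ord g dvd j" using eq gh by (simp add: pow_eq_id)
        then have "j = 0" using ij b(1) by (auto dest: dvd_imp_le)
        then show False using that(1) T True by simp
      next
        case False
        then have "P i" using eq ij b(1) unfolding P_def by (intro conjI exI[of _ j]) auto
        then have "i = k" using k_le ij by (simp add: le_antisym)
        then have "g [^] j = g [^] b" using eq b(2) gh
          by (metis inv_equality inv_inv inv_unique' nat_pow_closed)
        then have "j = b"
          using gh ij b(1) ord_inj[OF gh(1)] by (auto simp: inj_on_def)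
        then show False using that(2) T \<open>i = k\<close> by (simp add: A_def)
      qed
    qed
    then show ?thesis
      using k b gh sum2 by (auto simp: min_zero_sum_seqs_def zero_sum_seqs_def A_def split: if_splits)
  qed
  \<comment> \<open>In the \<open>N\<close>-fold repetition of \<open>A\<close> each multiplicity is
    a multiple of the order of its element, so it regroups into power atoms.\<close>
  define N where "N = ord g * ord h"
  define B where "B = repeat_mset N A"
  have "N \<in> length_set G {g, h} B"
    using length_set_repeat[OF length_set_atom[OF A], of N] by (simp add: B_def)
  moreover have "k * ord g + b * ord h \<in> length_set G {g, h} B"
  proof -
    have U: "replicate_mset (ord h) h \<in> min_zero_sum_seqs G {g, h}"
      "replicate_mset (ord g) g \<in> min_zero_sum_seqs G {g, h}"
      using gh pos by (auto intro: power_atom_seq)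
    have "k * ord g * 1 + b * ord h * 1 \<in> length_set G {g, h}
        (repeat_mset (k * ord g) (replicate_mset (ord h) h) + repeat_mset (b * ord h) (replicate_mset (ord g) g))"
      by (intro length_set_add length_set_repeat length_set_atom U)
    moreover have "repeat_mset (k * ord g) (replicate_mset (ord h) h) + repeat_mset (b * ord h) (replicate_mset (ord g) g) = B"
      using gh(3) by (intro multiset_eqI) (auto simp: B_def A_def N_def count_replicate_mset)
    ultimately show ?thesis by simp
  qed
  moreover have "B \<in> zero_sum_seqs G {g, h}"
  proof -
    have "set_mset A \<subseteq> {g, h}" "seq_sum G A = \<one>"
      using A by (auto simp: min_zero_sum_seqs_def zero_sum_seqs_def)
    then show ?thesis
      using gh seq_sum_repeat[of A N] set_mset_repeat_subset[of N A]
      unfolding zero_sum_seqs_def B_def by blast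
  qed
  moreover have "distances G {g, h} = {}" using hf by (simp add: half_factorial_def)
  ultimately have N: "N = k * ord g + b * ord h"
    using min_distance_le_diff(1)[of B G "{g, h}"] by (cases N "k * ord g + b * ord h" rule: linorder_cases) blast+
  \<comment> \<open>Coprimality makes \<open>ord h div c\<close> divide \<open>k\<close>; the
    hypothesis \<open>ex\<close> and the minimality of \<open>k\<close> give the reverse
    inequality.\<close>
  have "ord h dvd k * ord g" using N unfolding N_def by (metis dvd_add_left_iff dvd_triv_right)
  then have "ord h div c dvd k * (ord g div c)"
    using og oh \<open>c > 0\<close> by (metis dvd_mult_cancel_left mult.left_commute neq0_conv dvd_times_left_cancel_iff)
  moreover have "coprime (ord h div c) (ord g div c)"
    using pos unfolding c_def by (metis coprime_commute div_gcd_coprime less_numeral_extra(3))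
  ultimately have "ord h div c dvd k" by (simp add: coprime_dvd_mult_left_iff)
  then have "ord h div c \<le> k" using k by (auto dest: dvd_imp_le)
  with k_le[OF P0] have k_eq: "k = ord h div c" by simp
  \<comment> \<open>Cancelling \<open>ord h\<close> leaves \<open>ord g = ord g div c + b\<close>,
    so \<open>g [^] (ord g div c)\<close> and \<open>h [^] k\<close> are both inverse to
    \<open>g [^] b\<close>.\<close>
  have "ord h * ord g = ord h * (ord g div c + b)"
  proof -
    have "k * ord g = ord h * (ord g div c)"
      using og oh k_eq by (metis mult.assoc mult.commute)
    then show ?thesis using N unfolding N_def by (simp add: algebra_simps)
  qed
  then have "ord g = ord g div c + b" using pos by simp
  then have "g [^] (ord g div c) \<otimes> g [^] b = \<one>"
    using gh by (metis nat_pow_mult pow_ord_eq_1)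
  then have "g [^] (ord g div c) = h [^] k"
    using b(2) gh by (metis nat_pow_closed right_cancel)
  then show ?thesis by (simp add: k_eq c_def)
qed

text \<open>In exponents of a generator \<open>z\<close> with \<open>n = ord z\<close> and
  \<open>e = gcd i n\<close>: the order of \<open>x\<close> divides \<open>n div e\<close>, so the
  hypothesis on \<open>y\<close> forces \<open>e dvd j\<close>, which makes \<open>i * t = j\<close>
  solvable modulo \<open>n\<close>.\<close>

lemma cyclic_pow_ord_eq_one_imp_power:
  assumes "cyclic_group G" "finite (carrier G)" and x: "x \<in> carrier G" and y: "y \<in> carrier G"
    and "y [^] ord x = \<one>"
  shows "\<exists>t::nat. y = x [^] t"
proof -
  obtain z where z: "z \<in> carrier G" and range: "carrier G = range (\<lambda>n::int. z [^] n)"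
    using assms(1) cyclic_group by blast
  obtain i j :: int where i: "x = z [^] i" and j: "y = z [^] j" using x y range by auto
  define n where "n = int (ord z)"
  define m where "m = int (ord x)"
  have "n > 0" "m > 0" using ord_ge_1[OF assms(2)] x z by (auto simp: n_def m_def Suc_le_eq)
  define e where "e = gcd i n"
  have "e dvd n" "e dvd i" "e > 0" using \<open>n > 0\<close> by (auto simp: e_def)
  have "n dvd i * (n div e)"
  proof -
    obtain i' where "i = e * i'" using \<open>e dvd i\<close> ..
    then have "i * (n div e) = i' * n" using \<open>e dvd n\<close> by simp
    then show ?thesis by simp
  qed
  then have "x [^] (n div e) = \<one>"
    using z unfolding i n_def by (simp add: int_pow_pow int_pow_eq_id)
  then have "m dvd n div e" using x unfolding m_def by (simp add: int_pow_eq_id)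
  moreover have "y [^] m = \<one>" using assms(5) by (simp add: m_def int_pow_int)
  then have "n dvd j * m" using z unfolding j n_def by (simp add: int_pow_pow int_pow_eq_id)
  ultimately have "n dvd j * (n div e)" by (meson dvd_trans mult_dvd_mono dvd_refl)
  then have "(n div e) * e dvd (n div e) * j" using \<open>e dvd n\<close> by (simp add: mult.commute)
  moreover have "n div e \<noteq> 0" using \<open>e dvd n\<close> \<open>n > 0\<close> by (metis dvd_div_eq_0_iff less_numeral_extra(3))
  ultimately have "e dvd j" by simp
  then obtain t where "[i * t = j] (mod n)" using cong_solve_dvd_int unfolding e_def by blast
  then have "n dvd j - i * t" by (metis cong_iff_dvd_diff cong_sym)
  then have "z [^] (i * t) = z [^] j"
    using z unfolding n_def by (simp add: int_pow_eq)
  then have "x [^] t = y" using z unfolding i j by (simp add: int_pow_pow)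
  moreover have "x [^] nat (t mod m) = x [^] (t mod m)"
    using \<open>m > 0\<close> by (simp flip: int_pow_int)
  moreover have "x [^] (t mod m) = x [^] t"
    using x unfolding m_def by (simp add: int_pow_eq dvd_minus_mod)
  ultimately show ?thesis by metis
qed

text \<open>Locally at a prime \<open>p\<close>, all elements of \<open>S\<close> become explicit powers of an element \<open>h\<close> whose
  order has the largest \<open>p\<close>-part.\<close>

lemma seq_sum_eq_one_iff_local:
  assumes "finite (carrier G)" and S: "set_mset S \<subseteq> carrier G" "S \<noteq> {#}" and "prime p"
    and M: "order G = p ^ l * M" "\<not> p dvd M"
    and compat: "\<And>g h. g \<in># S \<Longrightarrow> h \<in># S \<Longrightarrow>
      g [^] (ord g div gcd (ord g) (ord h)) = h [^] (ord h div gcd (ord g) (ord h))"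
  shows "seq_sum G S [^] M = \<one> \<longleftrightarrow> order G dvd M * (\<Sum>g\<in>#S. order G div ord g)"
proof -
  have "\<exists>h\<in>set_mset S. \<forall>g\<in>set_mset S. multiplicity p (ord g) \<le> multiplicity p (ord h)"
  proof -
    define X where "X = (\<lambda>g. multiplicity p (ord g)) ` set_mset S"
    have "finite X" "X \<noteq> {}" using S(2) by (auto simp: X_def)
    then have "Max X \<in> X" "\<And>x. x \<in> X \<Longrightarrow> x \<le> Max X" by auto
    then show ?thesis unfolding X_def by (metis (no_types, lifting) imageE imageI)
  qed
  then obtain h where h: "h \<in># S" "\<And>g. g \<in># S \<Longrightarrow> multiplicity p (ord g) \<le> multiplicity p (ord h)"
    by blast
  have carr: "g \<in> carrier G" if "g \<in># S" for g using that S(1) by blast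
  have pos: "ord g > 0" if "g \<in># S" for g using ord_ge_1[OF assms(1) carr[OF that]] by simp
  define c where "c g = gcd (ord g) (ord h)" for g
  define e where "e g = (ord h div c g) * (M div (ord g div c g))" for g
  \<comment> \<open>The full \<open>p\<close>-part of \<open>ord g\<close> divides
    \<open>ord h\<close> and hence \<open>c g\<close>, so \<open>ord g div c g\<close> is prime to
    \<open>p\<close> and must divide \<open>M\<close>.\<close>
  have dvd_M: "ord g div c g dvd M" if g: "g \<in># S" for g
  proof -
    have "\<not> p dvd ord g div c g"
    proof
      assume "p dvd ord g div c g"
      then have "p * c g dvd ord g"
        by (metis c_def dvd_mult_div_cancel gcd_dvd1 mult.commute mult_dvd_mono dvd_refl)
      moreover have "p ^ multiplicity p (ord g) dvd c g"
        using h(2)[OF g] unfolding c_def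
        by (intro gcd_greatest multiplicity_dvd multiplicity_dvd')
      ultimately have "p ^ Suc (multiplicity p (ord g)) dvd ord g"
        by (metis dvd_trans mult_dvd_mono dvd_refl power_Suc)
      then show False
        using multiplicity_geI[of "ord g" p "Suc (multiplicity p (ord g))"] pos[OF g] \<open>prime p\<close>
        by (metis Suc_n_not_le_n neq0_conv not_prime_unit)
    qed
    then have "coprime (ord g div c g) (p ^ l)"
      using \<open>prime p\<close> by (metis coprime_commute coprime_power_right_iff prime_imp_coprime)
    moreover have "ord g div c g dvd p ^ l * M"
      unfolding M(1) [symmetric] using ord_dvd_group_order[OF carr[OF g]]
      by (metis c_def dvd_div_mult_self dvd_trans dvd_triv_left gcd_dvd1)
    ultimately show ?thesis by (simp add: coprime_dvd_mult_right_iff)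
  qed
  have "g [^] M = h [^] e g" if g: "g \<in># S" for g
  proof -
    have "g [^] M = (g [^] (ord g div c g)) [^] (M div (ord g div c g))"
      using carr[OF g] dvd_M[OF g] by (simp add: nat_pow_pow)
    also have "g [^] (ord g div c g) = h [^] (ord h div c g)"
      using compat[OF g h(1)] by (simp add: c_def)
    finally show ?thesis using carr[OF h(1)] by (simp add: nat_pow_pow e_def)
  qed
  then have pow: "seq_sum G S [^] M = h [^] (\<Sum>g\<in>#S. e g)"
    using carr h(1) by (intro seq_sum_pow) auto
  \<comment> \<open>As fractions, \<open>e g / ord h = M / ord g\<close>, so summing exponents
    multiplies the cross number of \<open>S\<close> by \<open>M\<close>; the factor
    \<open>order G\<close> clears denominators.\<close>
  have e_eq: "e g * order G = M * ord h * (order G div ord g)" if g: "g \<in># S" for g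
  proof -
    have "e g * ord g = M * ord h"
    proof -
      have "ord g = (ord g div c g) * c g" "ord h = (ord h div c g) * c g" "M = (M div (ord g div c g)) * (ord g div c g)"
        using dvd_M[OF g] by (simp_all add: c_def)
      then show ?thesis unfolding e_def by (metis mult.assoc mult.commute)
    qed
    moreover have "order G = ord g * (order G div ord g)"
      using ord_dvd_group_order[OF carr[OF g]] by simp
    ultimately show ?thesis by (metis mult.assoc)
  qed
  have "seq_sum G S [^] M = \<one> \<longleftrightarrow> ord h dvd (\<Sum>g\<in>#S. e g)"
    using carr[OF h(1)] by (simp add: pow pow_eq_id)
  also have "\<dots> \<longleftrightarrow> ord h * order G dvd (\<Sum>g\<in>#S. e g) * order G"
    using assms(1) by (simp add: order_gt_0_iff_finite)
  also have "(\<Sum>g\<in>#S. e g) * order G = (\<Sum>g\<in>#S. M * ord h * (order G div ord g))"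
    unfolding sum_mset_distrib_right using e_eq by (intro arg_cong[where f = sum_mset] image_mset_cong) auto
  also have "\<dots> = ord h * (M * (\<Sum>g\<in>#S. order G div ord g))"
    by (simp add: sum_mset_distrib_left mult_ac)
  also have "ord h * order G dvd \<dots> \<longleftrightarrow> order G dvd M * (\<Sum>g\<in>#S. order G div ord g)"
    using pos[OF h(1)] by simp
  finally show ?thesis .
qed

text \<open>The local criterion supplies an \<open>M\<close> prime to \<open>p\<close> for every
  prime \<open>p\<close>. In one direction \<open>n div gcd n w\<close> divides all these
  \<open>M\<close>, in the other the order of the sum does; a number dividing all of them has no
  prime divisor and is 1.\<close>

lemma seq_sum_eq_one_iff_order_dvd:
  assumes "finite (carrier G)" and S: "set_mset S \<subseteq> carrier G"
    and compat: "\<And>g h. g \<in># S \<Longrightarrow> h \<in># S \<Longrightarrow>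
      g [^] (ord g div gcd (ord g) (ord h)) = h [^] (ord h div gcd (ord g) (ord h))"
  shows "seq_sum G S = \<one> \<longleftrightarrow> order G dvd (\<Sum>g\<in>#S. order G div ord g)"
proof (cases "S = {#}")
  case False
  define n where "n = order G"
  define w where "w = (\<Sum>g\<in>#S. order G div ord g)"
  have "n > 0" using assms(1) by (simp add: n_def order_gt_0_iff_finite)
  have local: "\<exists>M. \<not> p dvd M \<and> (seq_sum G S [^] M = \<one> \<longleftrightarrow> n dvd M * w)" if p: "prime p" for p
  proof -
    obtain M where M: "n = p ^ multiplicity p n * M" "\<not> p dvd M"
      using multiplicity_decompose'[of n p] \<open>n > 0\<close> p by (metis not_prime_unit neq0_conv)
    then show ?thesis
      using seq_sum_eq_one_iff_local[OF assms(1) S False p, of "multiplicity p n" M] compat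
      unfolding n_def w_def by blast
  qed
  have carr: "seq_sum G S \<in> carrier G" using S by (rule seq_sum_closed)
  have "seq_sum G S = \<one> \<longleftrightarrow> n dvd w"
  proof
    assume one: "seq_sum G S = \<one>"
    define t where "t = n div gcd n w"
    have "t dvd M" if "n dvd M * w" for M
      using that \<open>n > 0\<close> unfolding t_def by (intro div_gcd_dvd)
    then have "\<not> p dvd t" if "prime p" for p
      using local[OF that] one by (metis dvd_trans nat_pow_one)
    then have "t = 1" using prime_factor_nat by blast
    then have "n = gcd n w" unfolding t_def by (metis dvd_div_mult_self gcd_dvd1 mult_1)
    then show "n dvd w" by (metis gcd_dvd2)
  next
    assume "n dvd w"
    then have "\<not> p dvd ord (seq_sum G S)" if "prime p" for p
      using local[OF that] carr by (metis dvd_mult dvd_trans pow_eq_id)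
    then have "ord (seq_sum G S) = 1" using prime_factor_nat by blast
    then show "seq_sum G S = \<one>" using carr by (metis ord_eq_1)
  qed
  then show ?thesis by (simp add: n_def w_def)
qed simp

end

theorem theorem2p4:
  fixes G :: "('a, 'b) monoid_scheme" (structure) and G0 :: "'a set"
  assumes "group G" and "cyclic_group G" and "finite (carrier G)" and "order G \<ge> 3"
    and "G0 \<subseteq> carrier G"
    and "real (min_distance G G0) \<ge> ln (real (order G))"
  shows "\<exists>G2. G2 \<subseteq> G0 \<and> card G2 = 2 \<and> \<not> half_factorial G G2"
proof (rule ccontr)
  assume no_pair: "\<not> ?thesis"
  have hf: "half_factorial G {g, h}" if gh: "g \<in> G0" "h \<in> G0" "g \<noteq> h" for g h
  proof (rule ccontr)
    assume "\<not> half_factorial G {g, h}"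
    moreover have "{g, h} \<subseteq> G0" "card {g, h} = 2" using gh by auto
    ultimately show False using no_pair by blast
  qed
  interpret comm_group G
    using assms(1,2) by (rule group.cyclic_imp_abelian_group)
  have ord_pos': "ord g > 0" if "g \<in> G0" for g
    using ord_ge_1[OF assms(3), of g] that assms(5) by auto
  have compat: "g [^] (ord g div gcd (ord g) (ord h)) = h [^] (ord h div gcd (ord g) (ord h))"
    if gh: "g \<in> G0" "h \<in> G0" for g h
  proof (cases "g = h")
    case False
    have carr: "g \<in> carrier G" "h \<in> carrier G" using gh assms(5) by auto
    \<comment> \<open>This shows that \<open>ord g\<close> annihilates the chosen power of
      \<open>h\<close>; in a finite cyclic group that makes it a power of \<open>g\<close>, as
      \<open>half_factorial_pair\<close> requires.\<close>
    have "ord h dvd ord h div gcd (ord g) (ord h) * ord g"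
      by (metis div_mult_swap dvd_triv_left gcd_dvd1 gcd_dvd2 dvd_div_mult)
    then have "(h [^] (ord h div gcd (ord g) (ord h))) [^] ord g = \<one>"
      using carr by (simp add: nat_pow_pow pow_eq_id)
    then have "\<exists>b::nat. h [^] (ord h div gcd (ord g) (ord h)) = g [^] b"
      using carr assms(2,3) by (intro cyclic_pow_ord_eq_one_imp_power) auto
    then show ?thesis
      using carr gh False ord_pos' hf by (intro half_factorial_pair) auto
  qed simp
  interpret divisor_weights G G0 "order G" "\<lambda>g. order G div ord g"
  proof
    show "order G > 0" using assms(4) by simp
    show "order G div ord g dvd order G" if "g \<in> G0" for g
      using that assms(5) ord_dvd_group_order by (metis dvd_div_mult_self dvd_triv_left subsetD)
    show "seq_sum G S = \<one> \<longleftrightarrow> order G dvd (\<Sum>g\<in>#S. order G div ord g)" if "set_mset S \<subseteq> G0" for S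
      using that assms(3,5) compat by (intro seq_sum_eq_one_iff_order_dvd) blast+
  qed
  show False
  proof (cases "\<forall>A\<in>atoms. wt A = order G")
    case True
    then have "distances G G0 = {}" by (intro distances_empty) auto
    \<comment> \<open>The convention for an empty set of distances gives 0, which is below
      \<open>ln (order G)\<close>.\<close>
    then have "min_distance G G0 = 0" by (simp add: min_distance_def)
    moreover have "ln (real (order G)) > 0" using assms(4) by simp
    ultimately show False using assms(6) by simp
  next
    case False
    then have "real (min_distance G G0) < ln (real (order G))"
      using assms(4) min_distance_less_ln by force
    then show False using assms(6) by simp
  qed
qed

end
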